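(* Let $K$ be a field in which $6\neq 0$ and let $E$ be any elliptic curve over $K$. Let $n\geq 4$ be any even integer not divisible by the characteristic of $K$. Then there exists an (explicit) finite, solvable extension $K'$ of $K$ over which $E$ has at least $2n$ rational points, i.e. $E(K')$ has at least $2n$ elements.
   Context: A finite extension $K'/K$ is solvable if it is separable and its Galois closure over $K$ has solvable Galois group. If $K$ has characteristic $0$, every integer $n\geq 4$ counts as not divisible by the characteristic. The word "explicit" is informal and carries no separate formal content. *)

theory Defs
  imports
    "HOL-Algebra.Algebraic_Closure_Type"
    "HOL-Algebra.Solvable_Groups"
    "HOL-Algebra.Bij"
begin

section \<open>Elliptic curves\<close>

text \<open>
  An elliptic curve is given by a Weierstrass equation
  \<open>y\<^sup>2 + a1 x y + a3 y = x\<^sup>3 + a2 x\<^sup>2 + a4 x + a6\<close> with non-vanishing discriminant.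
\<close>

record 'a weierstrass =
  a1 :: 'a
  a2 :: 'a
  a3 :: 'a
  a4 :: 'a
  a6 :: 'a

text \<open>
  The discriminant in terms of the usual quantities \<open>b2, b4, b6, b8\<close>; it is nonzero iff the
  projective closure of the affine curve is smooth.
\<close>

definition discriminant :: "'a :: comm_ring_1 weierstrass \<Rightarrow> 'a" where
  "discriminant E =
     (let b2 = a1 E ^ 2 + 4 * a2 E;
          b4 = 2 * a4 E + a1 E * a3 E;
          b6 = a3 E ^ 2 + 4 * a6 E;
          b8 = a1 E ^ 2 * a6 E + 4 * a2 E * a6 E - a1 E * a3 E * a4 E
                 + a2 E * a3 E ^ 2 - a4 E ^ 2
      in - (b2 ^ 2) * b8 - 8 * b4 ^ 3 - 27 * b6 ^ 2 + 9 * b2 * b4 * b6)"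

definition elliptic_curve :: "'a :: field weierstrass \<Rightarrow> bool" where
  "elliptic_curve E \<longleftrightarrow> discriminant E \<noteq> 0"

definition on_curve :: "'a :: comm_ring_1 weierstrass \<Rightarrow> 'a \<Rightarrow> 'a \<Rightarrow> bool" where
  "on_curve E x y \<longleftrightarrow>
     y ^ 2 + a1 E * x * y + a3 E * y = x ^ 3 + a2 E * x ^ 2 + a4 E * x + a6 E"

definition base_change :: "('a \<Rightarrow> 'b) \<Rightarrow> 'a weierstrass \<Rightarrow> 'b weierstrass" where
  "base_change h E =
     \<lparr> a1 = h (a1 E), a2 = h (a2 E), a3 = h (a3 E), a4 = h (a4 E), a6 = h (a6 E) \<rparr>"

datatype 'a curve_point = Infinity | Affine 'a 'a

text \<open>
  \<open>E(F)\<close> for an intermediate field \<open>F\<close> of the algebraic closure: the point at infinity is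
  the only point of the projective Weierstrass cubic on the line at infinity.
\<close>

definition rational_points ::
  "'a :: field weierstrass \<Rightarrow> 'a alg_closure set \<Rightarrow> 'a alg_closure curve_point set" where
  "rational_points E F =
     insert Infinity {Affine x y | x y. x \<in> F \<and> y \<in> F \<and> on_curve (base_change to_ac E) x y}"


section \<open>Solvable extensions\<close>

text \<open>
  The base field \<open>K\<close> is the type \<open>'a\<close>, embedded by \<open>to_ac\<close> in its algebraic closure
  \<open>'a alg_closure\<close>. Algebraic extensions of \<open>K\<close> are represented by the fields between
  \<open>K\<close> and the algebraic closure; up to \<open>K\<close>-isomorphism these are all of them.
\<close>

abbreviation (input) closure_ring :: "'a :: field alg_closure ring" where
  "closure_ring \<equiv> ring_of_type_algebra"

abbreviation (input) base_field :: "'a :: field alg_closure set" where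
  "base_field \<equiv> range to_ac"

definition intermediate_field :: "'a :: field alg_closure set \<Rightarrow> bool" where
  "intermediate_field F \<longleftrightarrow> subfield F closure_ring \<and> base_field \<subseteq> F"

definition finite_degree_extension :: "'a :: field alg_closure set \<Rightarrow> bool" where
  "finite_degree_extension F \<longleftrightarrow>
     intermediate_field F \<and> ring.finite_dimension closure_ring base_field F"

definition min_poly :: "'a :: field alg_closure \<Rightarrow> 'a poly" where
  "min_poly x = (THE p. Polynomial.lead_coeff p = 1 \<and> Factorial_Ring.irreducible p \<and>
                        poly (map_poly to_ac p) x = 0)"

definition separable_extension :: "'a :: field alg_closure set \<Rightarrow> bool" where
  "separable_extension F \<longleftrightarrow>
     intermediate_field F \<and> (\<forall>x\<in>F. rsquarefree (map_poly to_ac (min_poly x)))"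

definition normal_extension :: "'a :: field alg_closure set \<Rightarrow> bool" where
  "normal_extension F \<longleftrightarrow>
     intermediate_field F \<and>
     (\<forall>x\<in>F. \<forall>y. poly (map_poly to_ac (min_poly x)) y = 0 \<longrightarrow> y \<in> F)"

text \<open>
  This is the normal closure; it is the Galois closure of \<open>F\<close> over \<open>K\<close> when \<open>F\<close> is
  separable over \<open>K\<close>.
\<close>

definition galois_closure :: "'a :: field alg_closure set \<Rightarrow> 'a alg_closure set" where
  "galois_closure F = \<Inter> {N. normal_extension N \<and> F \<subseteq> N}"

definition galois_group ::
  "'a :: field alg_closure set \<Rightarrow> ('a alg_closure \<Rightarrow> 'a alg_closure) monoid" where
  "galois_group N =
     BijGroup N
       \<lparr> carrier := {\<sigma> \<in> Bij N.
           \<sigma> \<in> ring_hom (closure_ring \<lparr> carrier := N \<rparr>) (closure_ring \<lparr> carrier := N \<rparr>) \<and>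
           (\<forall>c. \<sigma> (to_ac c) = to_ac c)} \<rparr>"

definition solvable_extension :: "'a :: field alg_closure set \<Rightarrow> bool" where
  "solvable_extension F \<longleftrightarrow>
     separable_extension F \<and> solvable (galois_group (galois_closure F))"


section \<open>Well-definedness of the minimal polynomial\<close>

lemma map_poly_to_ac_mult: "map_poly to_ac (p * q) = map_poly to_ac p * map_poly to_ac q"
  for p q :: "'a :: field poly"
  by (rule poly_eqI) (simp add: coeff_map_poly coeff_mult to_ac_sum)

lemma map_poly_to_ac_add: "map_poly to_ac (p + q) = map_poly to_ac p + map_poly to_ac q"
  for p q :: "'a :: field poly"
  by (rule poly_eqI) (simp add: coeff_map_poly)

lemma ex1_min_poly:
  fixes x :: "'a :: field alg_closure"
  shows "\<exists>!p :: 'a poly. Polynomial.lead_coeff p = 1 \<and> Factorial_Ring.irreducible p \<and>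
           poly (map_poly to_ac p) x = 0"
proof -
  define R where "R = (\<lambda>p :: 'a poly. p \<noteq> 0 \<and> poly (map_poly to_ac p) x = 0)"
  obtain p0 where "R p0"
    using alg_closure_algebraic[of x] by (auto simp: R_def)
  then obtain q where q: "R q" "\<And>r. R r \<Longrightarrow> Polynomial.degree q \<le> Polynomial.degree r"
    using exists_least_iff[of "\<lambda>k. \<exists>p. R p \<and> Polynomial.degree p = k"] by (metis leI)
  define c where "c = Polynomial.lead_coeff q"
  have c: "c \<noteq> 0" using q by (auto simp: c_def R_def)
  define p where "p = Polynomial.smult (inverse c) q"
  have p_alt: "p = [:inverse c:] * q" by (simp add: p_def)
  have p: "R p" "Polynomial.lead_coeff p = 1" "Polynomial.degree p = Polynomial.degree q"
  proof -
    show "R p" using q(1) c unfolding p_alt R_def map_poly_to_ac_mult by auto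
  qed (use c in \<open>auto simp: p_def c_def\<close>)
  have min: "Polynomial.degree p \<le> Polynomial.degree r" if "R r" for r
    using q(2)[OF that] p(3) by simp
  have deg: "Polynomial.degree p \<noteq> 0"
  proof
    assume "Polynomial.degree p = 0"
    then obtain a where "p = [:a:]" using degree_eq_zeroE by blast
    with p(1) show False by (auto simp: R_def map_poly_pCons)
  qed
  have "a dvd 1 \<or> b dvd 1" if ab: "p = a * b" for a b
  proof -
    have nz: "a \<noteq> 0" "b \<noteq> 0" using p(1) ab by (auto simp: R_def)
    have "R a \<or> R b" using p(1) nz unfolding ab R_def map_poly_to_ac_mult by auto
    hence "Polynomial.degree a = 0 \<or> Polynomial.degree b = 0"
      using min[of a] min[of b] nz unfolding ab by (auto simp: degree_mult_eq)
    thus ?thesis using nz is_unit_iff_degree by blast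
  qed
  hence irr: "Factorial_Ring.irreducible p"
    using p(1) deg is_unit_iff_degree[of p] by (intro irreducibleI) (auto simp: R_def)
  show ?thesis
  proof (rule ex1I[of _ p])
    fix r assume r: "Polynomial.lead_coeff r = 1 \<and> Factorial_Ring.irreducible r \<and>
                     poly (map_poly to_ac r) x = 0"
    have "poly (map_poly to_ac (p * (r div p) + r mod p)) x = 0"
      using r by simp
    hence "poly (map_poly to_ac (r mod p)) x = 0"
      using p(1) unfolding map_poly_to_ac_add map_poly_to_ac_mult R_def by simp
    hence "r mod p = 0"
      using min[of "r mod p"] degree_mod_less[of p r] p(1) by (force simp: R_def)
    then obtain s where s: "r = p * s" by (auto simp: mod_eq_0_iff_dvd)
    have "s dvd 1"
      using r s deg p(1) irreducibleD[of r p s] is_unit_iff_degree[of p] by (auto simp: R_def)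
    then obtain a where a: "s = [:a:]" by (auto simp: is_unit_poly_iff)
    have "a = 1" using r p(2) unfolding s a by (auto split: if_splits)
    thus "r = p" using s a by simp
  qed (use irr p in \<open>auto simp: R_def\<close>)
qed

end

theory Submission
  imports Defs "HOL-Algebra.Multiplicative_Group"
begin

text \<open>
  The discriminant of the Weierstrass equation, as a quadratic in \<open>y\<close>, is a polynomial \<open>D(x)\<close>, so
  adjoining a square root of \<open>D(x)\<close> produces a point with abscissa \<open>x\<close>. If \<open>K\<close> is infinite, adjoin
  the square roots of \<open>D(x)\<close> for \<open>2 n\<close> elements \<open>x\<close> of \<open>K\<close>: the result is a multiquadratic
  extension, whose automorphisms are given by signs and hence commute. If \<open>K\<close> is finite, take the
  elements of a finite extension with at least \<open>2 n\<close> elements as abscissae; all square roots lie in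
  its quadratic extension, whose automorphisms commute because its multiplicative group is cyclic.
\<close>

section \<open>Intermediate fields\<close>

text \<open>Solvability comes from abelian Galois groups. The extensions built are themselves
  normal, so the Galois closure adds nothing. To prove separability and normality without computing
  minimal polynomials, each element is given a polynomial over \<open>K\<close> that annihilates it,
  has only simple roots and has all its roots in the extension; the minimal polynomial divides it.
  For finite \<open>K\<close> a single polynomial X^q - X serves all elements. For infinite
  \<open>K\<close> it is Artin's product over an orbit, which needs a finite set of automorphisms
  whose common fixed elements lie in \<open>K\<close>; sign changes of the adjoined roots provide
  one, as 2 is nonzero. The case split comes from counting: points are told apart by their abscissae
  alone, and a finite \<open>K\<close> may have fewer than 2n elements. For infinite
  \<open>K\<close>, abscissae in \<open>K\<close> keep all radicands in \<open>K\<close>, and this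
  is what makes the automorphisms act on the roots by signs.\<close>

lemma ring_of_type_algebra_simps [simp]:
  "carrier (ring_of_type_algebra :: 'a :: comm_ring_1 ring) = UNIV"
  "x \<otimes>\<^bsub>ring_of_type_algebra\<^esub> y = x * y"
  "x \<oplus>\<^bsub>ring_of_type_algebra\<^esub> y = x + y"
  "\<one>\<^bsub>ring_of_type_algebra\<^esub> = (1 :: 'a)"
  "\<zero>\<^bsub>ring_of_type_algebra\<^esub> = (0 :: 'a)"
  by (simp_all add: ring_of_type_algebra_def)

lemma a_inv_ring_of_type_algebra [simp]:
  "\<ominus>\<^bsub>ring_of_type_algebra\<^esub> x = - (x :: 'a :: comm_ring_1)"
proof -
  interpret cring "ring_of_type_algebra :: 'a ring" by (rule cring_from_type_algebra)
  show ?thesis by (rule minus_equality) simp_all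
qed

lemma m_inv_ring_of_type_algebra [simp]:
  assumes "x \<noteq> 0"
  shows "inv\<^bsub>ring_of_type_algebra\<^esub> x = inverse (x :: 'a :: field)"
proof -
  interpret cring "ring_of_type_algebra :: 'a ring" by (rule cring_from_type_algebra)
  show ?thesis using assms by (intro comm_inv_char) simp_all
qed

lemma subfield_ring_of_type_algebraI:
  fixes F :: "'a :: field set"
  assumes "1 \<in> F" "\<And>x y. x \<in> F \<Longrightarrow> y \<in> F \<Longrightarrow> x + y \<in> F" "\<And>x y. x \<in> F \<Longrightarrow> y \<in> F \<Longrightarrow> x * y \<in> F"
    and "\<And>x. x \<in> F \<Longrightarrow> - x \<in> F" "\<And>x. x \<in> F \<Longrightarrow> inverse x \<in> F"
  shows "subfield F ring_of_type_algebra"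
proof -
  interpret field "ring_of_type_algebra :: 'a ring" by (rule field_from_type_algebra)
  show ?thesis using assms by (intro subfieldI' subringI) auto
qed

lemma subfield_base_field: "subfield (base_field :: 'a :: field alg_closure set) closure_ring"
  by (rule subfield_ring_of_type_algebraI)
     (auto simp flip: to_ac_1 to_ac_add to_ac_mult to_ac_minus to_ac_inverse)

lemma intermediate_fieldI:
  fixes F :: "'a :: field alg_closure set"
  assumes "range to_ac \<subseteq> F"
    and "\<And>x y. x \<in> F \<Longrightarrow> y \<in> F \<Longrightarrow> x + y \<in> F" "\<And>x y. x \<in> F \<Longrightarrow> y \<in> F \<Longrightarrow> x * y \<in> F"
    and "\<And>x. x \<in> F \<Longrightarrow> inverse x \<in> F"
  shows "intermediate_field F"
proof -
  have "1 \<in> F" "- 1 \<in> F" using assms(1) to_ac_1 to_ac_minus by (metis rangeI subsetD)+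
  moreover have "- x \<in> F" if "x \<in> F" for x using assms(3)[OF \<open>- 1 \<in> F\<close> that] by simp
  ultimately show ?thesis
    using assms unfolding intermediate_field_def by (auto intro!: subfield_ring_of_type_algebraI)
qed

lemma intermediate_field_base: "intermediate_field (base_field :: 'a :: field alg_closure set)"
  by (simp add: intermediate_field_def subfield_base_field)

context
  fixes F :: "'a :: field alg_closure set"
  assumes F: "intermediate_field F"
begin

lemma intermediate_field_base_mem: "to_ac c \<in> F"
  using F by (auto simp: intermediate_field_def)

lemma intermediate_field_zero: "0 \<in> F" and intermediate_field_one: "1 \<in> F"
  and intermediate_field_numeral: "numeral k \<in> F"
  using intermediate_field_base_mem[of 0] intermediate_field_base_mem[of 1]
    intermediate_field_base_mem[of "numeral k"] by simp_all

lemma intermediate_field_add: "x \<in> F \<Longrightarrow> y \<in> F \<Longrightarrow> x + y \<in> F"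
  and intermediate_field_mult: "x \<in> F \<Longrightarrow> y \<in> F \<Longrightarrow> x * y \<in> F"
  and intermediate_field_uminus: "x \<in> F \<Longrightarrow> - x \<in> F"
proof -
  have "subring F closure_ring" using F subfieldE(1) by (auto simp: intermediate_field_def)
  from subringE(5-7)[OF this]
  show "x \<in> F \<Longrightarrow> y \<in> F \<Longrightarrow> x + y \<in> F" "x \<in> F \<Longrightarrow> y \<in> F \<Longrightarrow> x * y \<in> F" "x \<in> F \<Longrightarrow> - x \<in> F"
    by simp_all
qed

lemma intermediate_field_inverse: "x \<in> F \<Longrightarrow> inverse x \<in> F"
proof (cases "x = 0")
  case False
  interpret field "closure_ring :: 'a alg_closure ring" by (rule field_from_type_algebra)
  assume "x \<in> F"
  moreover have "subfield F closure_ring" using F by (simp add: intermediate_field_def)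
  ultimately show ?thesis
    using False subfield_m_inv(1)[of F x] by simp
qed simp

lemma intermediate_field_diff: "x \<in> F \<Longrightarrow> y \<in> F \<Longrightarrow> x - y \<in> F"
  using intermediate_field_add[of x "- y"] intermediate_field_uminus by simp

lemma intermediate_field_divide: "x \<in> F \<Longrightarrow> y \<in> F \<Longrightarrow> x / y \<in> F"
  using intermediate_field_mult[of x "inverse y"] intermediate_field_inverse
  by (simp add: field_class.field_divide_inverse)

lemma intermediate_field_power: "x \<in> F \<Longrightarrow> x ^ k \<in> F"
  by (induction k) (auto intro: intermediate_field_one intermediate_field_mult)

lemmas intermediate_field_closed =
  intermediate_field_base_mem intermediate_field_zero intermediate_field_one
  intermediate_field_numeral intermediate_field_add intermediate_field_mult
  intermediate_field_uminus intermediate_field_inverse intermediate_field_diff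
  intermediate_field_divide intermediate_field_power

end

section \<open>Finite degree\<close>

abbreviation base_span :: "'a :: field alg_closure list \<Rightarrow> 'a alg_closure set" where
  "base_span \<equiv> ring.Span closure_ring base_field"

lemma base_span_Nil: "base_span [] = {0 :: 'a :: field alg_closure}"
proof -
  interpret ring "closure_ring :: 'a alg_closure ring" by (rule ring_from_type_algebra)
  show ?thesis by simp
qed

lemma base_span_Cons:
  "base_span (u # us) = {to_ac c * u + e | c e. e \<in> base_span us}"
  for u :: "'a :: field alg_closure"
proof -
  interpret ring "closure_ring :: 'a alg_closure ring" by (rule ring_from_type_algebra)
  have "base_span (u # us) = line_extension base_field u (base_span us)" by simp
  thus ?thesis
    by (auto simp: line_extension_def set_add_def' r_coset_def simp del: Span.simps)
qed

lemma base_span_zero: "0 \<in> base_span us"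
proof (induction us)
  case (Cons u us)
  have "0 = to_ac 0 * u + 0" by simp
  with Cons.IH show ?case unfolding base_span_Cons by blast
qed (simp add: base_span_Nil)

lemma base_span_superset: "set us \<subseteq> base_span us"
proof (induction us)
  case (Cons u us)
  have "u = to_ac 1 * u + 0" by simp
  hence "u \<in> base_span (u # us)"
    using base_span_zero[of us] unfolding base_span_Cons by blast
  moreover have "v \<in> base_span (u # us)" if "v \<in> base_span us" for v
  proof -
    have "v = to_ac 0 * u + v" by simp
    with that show ?thesis unfolding base_span_Cons by blast
  qed
  ultimately show ?case using Cons.IH by auto
qed simp

lemma base_span_least:
  assumes "intermediate_field F" "set us \<subseteq> F"
  shows "base_span us \<subseteq> F"
  using assms(2)
  by (induction us)
     (auto simp: base_span_Nil base_span_Cons intro!: intermediate_field_closed[OF assms(1)])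

text \<open>Together with \<open>base_span_mult\<close> this turns a spanning list of F into one of
  F + F s, so that finite degree survives the adjunction of a square root.\<close>

lemma base_span_append: "base_span (us @ vs) = {a + b | a b. a \<in> base_span us \<and> b \<in> base_span vs}"
proof (induction us)
  case (Cons u us)
  show ?case
    unfolding append_Cons base_span_Cons Cons.IH
    by (intro equalityI subsetI; clarsimp) (metis add.assoc)+
qed (simp add: base_span_Nil)

lemma base_span_mult: "base_span (map ((*) s) us) = (*) s ` base_span us"
proof (induction us)
  case (Cons u us)
  show ?case
    by (simp add: base_span_Cons Cons.IH) (force simp: algebra_simps image_iff)
qed (simp add: base_span_Nil)

lemma finite_degree_extension_base_span:
  assumes "intermediate_field (base_span us)"
  shows "finite_degree_extension (base_span us)"
proof -
  interpret ring "closure_ring :: 'a alg_closure ring" by (rule ring_from_type_algebra)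
  show ?thesis
    using assms Span_finite_dimension[OF subfield_base_field]
    unfolding finite_degree_extension_def by (simp del: Span.simps)
qed

section \<open>Separable normal extensions\<close>

text \<open>A nonzero polynomial \<open>r\<close> of least degree vanishing at \<open>x\<close>
  divides every polynomial vanishing there, by division with remainder. In particular it divides the
  irreducible \<open>min_poly x\<close>, hence is associated to it.\<close>

lemma min_poly_dvd:
  fixes q :: "'a :: field poly"
  assumes "poly (map_poly to_ac q) x = 0"
  shows "min_poly x dvd q"
proof -
  define m where "m = min_poly x"
  have m: "Factorial_Ring.irreducible m" "poly (map_poly to_ac m) x = 0"
    using theI'[OF ex1_min_poly[of x]] by (simp_all add: m_def min_poly_def)
  define R where "R = (\<lambda>p :: 'a poly. p \<noteq> 0 \<and> poly (map_poly to_ac p) x = 0)"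
  have "R m" using m by (auto simp: R_def)
  then obtain r where r: "R r" "\<And>p. R p \<Longrightarrow> Polynomial.degree r \<le> Polynomial.degree p"
    using exists_least_iff[of "\<lambda>k. \<exists>p. R p \<and> Polynomial.degree p = k"] by (metis leI)
  have dvd: "r dvd p" if "poly (map_poly to_ac p) x = 0" for p
  proof -
    have "poly (map_poly to_ac (r * (p div r) + p mod r)) x = 0" using that by simp
    hence "poly (map_poly to_ac (p mod r)) x = 0"
      using r(1) unfolding map_poly_to_ac_add map_poly_to_ac_mult R_def by simp
    hence "p mod r = 0"
      using r(2)[of "p mod r"] degree_mod_less[of r p] r(1) by (force simp: R_def)
    thus ?thesis by (simp add: mod_eq_0_iff_dvd)
  qed
  obtain u where u: "m = r * u" using dvd[OF m(2)] by (auto elim: dvdE)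
  have "\<not> r dvd 1"
  proof
    assume "r dvd 1"
    then obtain c where "r = [:c:]" by (auto simp: is_unit_poly_iff)
    thus False using r(1) by (auto simp: R_def map_poly_pCons)
  qed
  hence "u dvd 1" using irreducibleD[OF m(1) u] by blast
  hence "m dvd r" using u by (metis dvd_mult_unit_iff' dvd_refl mult.commute)
  thus ?thesis using dvd[OF assms] unfolding m_def by (rule dvd_trans)
qed

lemma map_poly_to_ac_dvd: "p dvd q \<Longrightarrow> map_poly to_ac p dvd map_poly to_ac q"
  for p q :: "'a :: field poly"
  by (auto elim!: dvdE simp: map_poly_to_ac_mult)

lemma poly_dvd_imp_root: "p dvd q \<Longrightarrow> poly p a = 0 \<Longrightarrow> poly q a = 0"
  by (auto elim!: dvdE)

lemma rsquarefree_dvd: "rsquarefree p" if "rsquarefree q" "p dvd q"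
proof -
  have "q \<noteq> 0" "p \<noteq> 0" using that by (auto simp: rsquarefree_def)
  moreover have "Polynomial.order a p \<le> Polynomial.order a q" for a
    using that(2) \<open>q \<noteq> 0\<close> by (rule dvd_imp_order_le[rotated])
  moreover have "Polynomial.order a q \<le> 1" for a
    using that(1) by (auto simp: rsquarefree_def le_Suc_eq)
  ultimately show ?thesis
    unfolding rsquarefree_def by (metis One_nat_def le_0_eq le_SucE order_trans)
qed

definition split_by_squarefree :: "'a :: field alg_closure set \<Rightarrow> bool" where
  "split_by_squarefree F \<longleftrightarrow> (\<forall>x\<in>F. \<exists>q :: 'a poly. poly (map_poly to_ac q) x = 0 \<and>
      rsquarefree (map_poly to_ac q) \<and> (\<forall>y. poly (map_poly to_ac q) y = 0 \<longrightarrow> y \<in> F))"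

lemma
  fixes F :: "'a :: field alg_closure set"
  assumes "intermediate_field F" "split_by_squarefree F"
  shows split_by_squarefree_imp_separable: "separable_extension F"
    and split_by_squarefree_imp_normal: "normal_extension F"
proof -
  have *: "rsquarefree (map_poly to_ac (min_poly x)) \<and>
      (\<forall>y. poly (map_poly to_ac (min_poly x)) y = 0 \<longrightarrow> y \<in> F)" if "x \<in> F" for x
  proof -
    obtain q :: "'a poly" where q: "poly (map_poly to_ac q) x = 0" "rsquarefree (map_poly to_ac q)"
      "\<And>y. poly (map_poly to_ac q) y = 0 \<Longrightarrow> y \<in> F"
      using assms(2) \<open>x \<in> F\<close> unfolding split_by_squarefree_def by blast
    have dvd: "map_poly to_ac (min_poly x) dvd map_poly to_ac q"
      by (intro map_poly_to_ac_dvd min_poly_dvd q)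
    show ?thesis
      using rsquarefree_dvd[OF q(2) dvd] q(3) poly_dvd_imp_root[OF dvd] by simp
  qed
  thus "separable_extension F" "normal_extension F"
    using assms(1) by (auto simp: separable_extension_def normal_extension_def)
qed

lemma galois_closure_normal: "normal_extension F \<Longrightarrow> galois_closure F = F"
  by (auto simp: galois_closure_def)

section \<open>Abelian Galois groups\<close>

text \<open>Only values on \<open>F\<close> and on the base field are constrained, and no codomain
  is imposed. Thus the restricted bijections of \<open>galois_group\<close>, their plain composites
  and explicitly defined maps are all covered.\<close>

definition base_hom :: "'a :: field alg_closure set \<Rightarrow> ('a alg_closure \<Rightarrow> 'a alg_closure) \<Rightarrow> bool" where
  "base_hom F f \<longleftrightarrow> (\<forall>x\<in>F. \<forall>y\<in>F. f (x + y) = f x + f y \<and> f (x * y) = f x * f y) \<and>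
     (\<forall>c. f (to_ac c) = to_ac c)"

lemma carrier_galois_group:
  assumes "intermediate_field F"
  shows "carrier (galois_group F) = {\<sigma> \<in> Bij F. base_hom F \<sigma>}"
  using Bij_imp_funcset[of _ F]
  by (auto simp: galois_group_def base_hom_def ring_hom_def to_ac_1[symmetric] simp del: to_ac_1)

lemma group_galois_group:
  assumes F: "intermediate_field F"
  shows "group (galois_group F)"
proof -
  interpret B: group "BijGroup F" by (rule group_BijGroup)
  let ?H = "{\<sigma> \<in> Bij F. base_hom F \<sigma>}"
  note closed = intermediate_field_closed[OF F]
  have "subgroup ?H (BijGroup F)"
  proof
    show "?H \<subseteq> carrier (BijGroup F)" by (auto simp: BijGroup_def)
    show "\<one>\<^bsub>BijGroup F\<^esub> \<in> ?H"
      using id_Bij[of F] closed by (auto simp: BijGroup_def base_hom_def)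
  next
    fix \<sigma> \<tau> assume "\<sigma> \<in> ?H" "\<tau> \<in> ?H"
    moreover from this have "\<sigma> x \<in> F" "\<tau> x \<in> F" if "x \<in> F" for x
      using that Bij_imp_funcset by auto
    ultimately show "\<sigma> \<otimes>\<^bsub>BijGroup F\<^esub> \<tau> \<in> ?H"
      using compose_Bij[of \<sigma> F \<tau>] closed by (auto simp: BijGroup_def base_hom_def compose_def)
  next
    fix \<sigma> assume \<sigma>: "\<sigma> \<in> ?H"
    hence bij: "bij_betw \<sigma> F F" by (simp add: Bij_def)
    \<comment> \<open>The inverse of a bijection compatible with a binary operation is compatible
      with it as well; this is used once for addition and once for multiplication.\<close>
    have "inv_into F \<sigma> (x + y) = inv_into F \<sigma> x + inv_into F \<sigma> y"
         "inv_into F \<sigma> (x * y) = inv_into F \<sigma> x * inv_into F \<sigma> y" if "x \<in> F" "y \<in> F" for x y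
      using that \<sigma> closed
      by (intro Bij_inv_into_lemma; auto simp: base_hom_def)+
    moreover have "inv_into F \<sigma> (to_ac c) = to_ac c" for c
      using \<sigma> bij closed by (metis (lifting) base_hom_def bij_betw_def inv_into_f_f mem_Collect_eq)
    ultimately have "base_hom F (\<lambda>x\<in>F. inv_into F \<sigma> x)"
      using closed by (auto simp: base_hom_def)
    thus "inv\<^bsub>BijGroup F\<^esub> \<sigma> \<in> ?H"
      using \<sigma> restrict_inv_into_Bij[of \<sigma> F] by (auto simp: inv_BijGroup)
  qed
  hence "group (BijGroup F \<lparr> carrier := ?H \<rparr>)" by (rule B.subgroup_imp_group)
  moreover have "galois_group F = BijGroup F \<lparr> carrier := ?H \<rparr>"
    using carrier_galois_group[OF F] by (simp add: galois_group_def)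
  ultimately show ?thesis by simp
qed

lemma (in comm_group) solvable: "solvable G"
  using trivial_derived_seq_imp_solvable[OF subgroup_self, of 1] derived_eq_singleton[of "carrier G"]
  by (simp add: solvable_def)

text \<open>Normality gives \<open>galois_closure F = F\<close>, so the group in question consists
  of the automorphisms of \<open>F\<close> itself. The commutation hypothesis makes it
  abelian.\<close>

lemma solvable_extensionI:
  assumes F: "intermediate_field F" and split: "split_by_squarefree F"
    and comm: "\<And>\<sigma> \<tau> x. \<lbrakk>base_hom F \<sigma>; base_hom F \<tau>; \<sigma> ` F = F; \<tau> ` F = F; x \<in> F\<rbrakk>
                 \<Longrightarrow> \<sigma> (\<tau> x) = \<tau> (\<sigma> x)"
  shows "solvable_extension F"
proof -
  interpret group "galois_group F" by (rule group_galois_group[OF F])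
  have "comm_group (galois_group F)"
  proof (rule group_comm_groupI)
    fix \<sigma> \<tau> assume st: "\<sigma> \<in> carrier (galois_group F)" "\<tau> \<in> carrier (galois_group F)"
    hence "\<sigma> (\<tau> x) = \<tau> (\<sigma> x)" if "x \<in> F" for x
      using that by (intro comm) (auto simp: carrier_galois_group[OF F] Bij_def bij_betw_def)
    hence "compose F \<sigma> \<tau> = compose F \<tau> \<sigma>"
      by (auto simp: compose_def fun_eq_iff)
    thus "\<sigma> \<otimes>\<^bsub>galois_group F\<^esub> \<tau> = \<tau> \<otimes>\<^bsub>galois_group F\<^esub> \<sigma>"
      using st by (auto simp: carrier_galois_group[OF F]) (auto simp: galois_group_def BijGroup_def)
  qed
  hence "solvable (galois_group F)" by (rule comm_group.solvable)
  thus ?thesis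
    using split_by_squarefree_imp_separable[OF F split]
      galois_closure_normal[OF split_by_squarefree_imp_normal[OF F split]]
    by (simp add: solvable_extension_def)
qed

section \<open>Multiquadratic extensions\<close>

lemma base_hom_add: "base_hom F f \<Longrightarrow> x \<in> F \<Longrightarrow> y \<in> F \<Longrightarrow> f (x + y) = f x + f y"
  and base_hom_mult: "base_hom F f \<Longrightarrow> x \<in> F \<Longrightarrow> y \<in> F \<Longrightarrow> f (x * y) = f x * f y"
  and base_hom_base: "base_hom F f \<Longrightarrow> f (to_ac c) = to_ac c"
  by (auto simp: base_hom_def)

lemma base_hom_zero: "base_hom F f \<Longrightarrow> f 0 = 0"
  and base_hom_one: "base_hom F f \<Longrightarrow> f 1 = 1"
  using base_hom_base[of F f 0] base_hom_base[of F f 1] by simp_all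

lemma base_hom_uminus:
  assumes "intermediate_field F" "base_hom F f" "x \<in> F"
  shows "f (- x) = - f x"
  using base_hom_mult[of F f "to_ac (- 1)" x] base_hom_base[of F f "- 1"] assms
    intermediate_field_base_mem[OF assms(1), of "- 1"] by simp

lemma base_hom_power:
  assumes "intermediate_field F" "base_hom F f" "x \<in> F"
  shows "f (x ^ k) = f x ^ k"
  using assms
  by (induction k) (auto simp: base_hom_one base_hom_mult intermediate_field_power)

lemma base_hom_inj:
  assumes F: "intermediate_field F" and f: "base_hom F f"
  shows "inj_on f F"
proof (rule inj_onI, rule ccontr)
  fix x y assume xy: "x \<in> F" "y \<in> F" "f x = f y" "x \<noteq> y"
  let ?d = "x - y"
  have d: "?d \<in> F" "inverse ?d \<in> F" using F xy by (auto intro!: intermediate_field_closed)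
  have "f (?d + y) = f ?d + f y" using f d xy by (intro base_hom_add) auto
  hence "f ?d = 0" using xy by simp
  hence "f (?d * inverse ?d) = 0" using base_hom_mult[OF f d] by simp
  thus False using xy base_hom_one[OF f] by simp
qed

section \<open>Orbit polynomials and Artin's argument\<close>

lemma rsquarefree_prod_linear:
  fixes A :: "'a :: idom set"
  assumes "finite A"
  shows "rsquarefree (\<Prod>y\<in>A. [:- y, 1:])"
proof -
  have nz: "(\<Prod>y\<in>A. [:- y, 1:]) \<noteq> 0" using assms by (simp add: prod_zero_iff)
  have "proots (\<Prod>y\<in>A. [:- y, 1:]) = (\<Sum>y\<in>A. {#y#})" by (subst proots_prod) auto
  hence "Polynomial.order a (\<Prod>y\<in>A. [:- y, 1:]) = count (\<Sum>y\<in>A. {#y#}) a" for a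
    using count_proots[OF nz, of a] by simp
  moreover have "count (\<Sum>y\<in>A. {#y#}) a = (if a \<in> A then 1 else 0)" for a
    using assms by (simp add: count_sum)
  ultimately show ?thesis using nz by (simp add: rsquarefree_def)
qed

text \<open>Membership in \<open>F\<close> is carried through the induction because \<open>f\<close>
  is additive and multiplicative only there. The right-hand product runs over \<open>A\<close>, not
  over its image, so injectivity of \<open>f\<close> enters only when the product is
  reindexed.\<close>

lemma coeff_prod_linear_base_hom:
  assumes F: "intermediate_field F" and f: "base_hom F f" and A: "finite A" "A \<subseteq> F"
  shows "Polynomial.coeff (\<Prod>y\<in>A. [:- y, 1:]) i \<in> F \<and>
         f (Polynomial.coeff (\<Prod>y\<in>A. [:- y, 1:]) i) = Polynomial.coeff (\<Prod>y\<in>A. [:- f y, 1:]) i"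
  using A
proof (induction A arbitrary: i rule: finite_induct)
  case empty
  show ?case
    using F by (simp add: Polynomial.coeff_1 base_hom_zero[OF f] base_hom_one[OF f]
        intermediate_field_zero intermediate_field_one)
next
  case (insert z A)
  have *: "Polynomial.coeff ([:c, 1:] * Q) i =
      c * Polynomial.coeff Q i + (if i = 0 then 0 else Polynomial.coeff Q (i - 1))"
    for c :: "'a alg_closure" and Q i
    by (cases i) auto
  have IH: "Polynomial.coeff (\<Prod>y\<in>A. [:- y, 1:]) j \<in> F"
     "f (Polynomial.coeff (\<Prod>y\<in>A. [:- y, 1:]) j) = Polynomial.coeff (\<Prod>y\<in>A. [:- f y, 1:]) j" for j
    using insert by auto
  have z: "z \<in> F" "- z \<in> F" using insert F by (auto intro: intermediate_field_uminus)
  let ?a = "- z * Polynomial.coeff (\<Prod>y\<in>A. [:- y, 1:]) i"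
  let ?b = "if i = 0 then 0 else Polynomial.coeff (\<Prod>y\<in>A. [:- y, 1:]) (i - 1)"
  have a: "?a \<in> F" by (intro intermediate_field_mult[OF F] z IH)
  have b: "?b \<in> F" using intermediate_field_zero[OF F] IH(1) by simp
  have eq: "f (?a + ?b) = - f z * Polynomial.coeff (\<Prod>y\<in>A. [:- f y, 1:]) i +
     (if i = 0 then 0 else Polynomial.coeff (\<Prod>y\<in>A. [:- f y, 1:]) (i - 1))"
    unfolding base_hom_add[OF f a b] base_hom_mult[OF f z(2) IH(1)]
      base_hom_uminus[OF F f z(1)] IH(2)
    using IH(2)[of "i - 1"] base_hom_zero[OF f] by simp
  show ?case
    unfolding prod.insert[OF insert.hyps] *
    using intermediate_field_add[OF F a b] eq by (rule conjI)
qed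

text \<open>The members of \<open>G\<close> are functions on the whole closure, so composition and
  identity are demanded only up to equality on \<open>F\<close>. In place of inverses, finiteness of
  \<open>G\<close> and injectivity of homomorphisms make each member permute every orbit.\<close>

definition fixed_field_base ::
  "'a :: field alg_closure set \<Rightarrow> ('a alg_closure \<Rightarrow> 'a alg_closure) set \<Rightarrow> bool" where
  "fixed_field_base F G \<longleftrightarrow> finite G \<and> (\<forall>\<sigma>\<in>G. base_hom F \<sigma> \<and> \<sigma> ` F \<subseteq> F) \<and>
     (\<forall>\<sigma>\<in>G. \<forall>\<tau>\<in>G. \<exists>\<rho>\<in>G. \<forall>x\<in>F. \<rho> x = \<sigma> (\<tau> x)) \<and> (\<exists>\<iota>\<in>G. \<forall>x\<in>F. \<iota> x = x) \<and>
     (\<forall>x\<in>F. (\<forall>\<sigma>\<in>G. \<sigma> x = x) \<longrightarrow> x \<in> base_field)"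

lemma fixed_field_base_comp:
  assumes "fixed_field_base F G" "\<sigma> \<in> G" "\<tau> \<in> G"
  obtains \<rho> where "\<rho> \<in> G" "\<forall>x\<in>F. \<rho> x = \<sigma> (\<tau> x)"
proof -
  have "\<forall>\<sigma>\<in>G. \<forall>\<tau>\<in>G. \<exists>\<rho>\<in>G. \<forall>x\<in>F. \<rho> x = \<sigma> (\<tau> x)"
    using assms(1) unfolding fixed_field_base_def by (elim conjE)
  from bspec[OF bspec[OF this assms(2)] assms(3)] show thesis by (rule bexE) (rule that)
qed

lemma fixed_field_base_id:
  assumes "fixed_field_base F G"
  obtains \<iota> where "\<iota> \<in> G" "\<forall>x\<in>F. \<iota> x = x"
proof -
  have "\<exists>\<iota>\<in>G. \<forall>x\<in>F. \<iota> x = x"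
    using assms unfolding fixed_field_base_def by (elim conjE)
  then show thesis by (rule bexE) (rule that)
qed

lemma fixed_field_base_fixed:
  assumes "fixed_field_base F G" "x \<in> F" "\<And>\<sigma>. \<sigma> \<in> G \<Longrightarrow> \<sigma> x = x"
  shows "x \<in> base_field"
proof -
  have "\<forall>x\<in>F. (\<forall>\<sigma>\<in>G. \<sigma> x = x) \<longrightarrow> x \<in> base_field"
    using assms(1) unfolding fixed_field_base_def by (elim conjE)
  thus ?thesis using assms(2,3) by simp
qed

text \<open>Artin: the coefficients of the product of \<open>X - y\<close> over the \<open>G\<close>-orbit of \<open>x\<close> are fixed by \<open>G\<close>.\<close>

lemma fixed_field_base_imp_split:
  fixes F :: "'a :: field alg_closure set"
  assumes F: "intermediate_field F" and G: "fixed_field_base F G"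
  shows "split_by_squarefree F"
  unfolding split_by_squarefree_def
proof
  fix x assume x: "x \<in> F"
  define A where "A = (\<lambda>\<sigma>. \<sigma> x) ` G"
  define P where "P = (\<Prod>y\<in>A. [:- y, 1:])"
  have A: "finite A" "A \<subseteq> F" using G x by (auto simp: A_def fixed_field_base_def)
  obtain \<iota> where \<iota>: "\<iota> \<in> G" "\<forall>x\<in>F. \<iota> x = x"
    using G by (rule fixed_field_base_id)
  have "\<iota> x \<in> A" unfolding A_def using \<iota>(1) by (rule imageI)
  hence xA: "x \<in> A" using \<iota>(2) x by simp
  have roots: "poly P y = 0 \<longleftrightarrow> y \<in> A" for y
    using A by (auto simp: P_def poly_prod)
  have "Polynomial.coeff P i \<in> base_field" for i
  proof -
    have "\<sigma> (Polynomial.coeff P i) = Polynomial.coeff P i" if \<sigma>: "\<sigma> \<in> G" for \<sigma>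
    proof -
      have hom: "base_hom F \<sigma>" using G \<sigma> by (simp add: fixed_field_base_def)
      have inj: "inj_on \<sigma> A" using base_hom_inj[OF F hom] A(2) by (rule inj_on_subset)
      have "\<sigma> ` A \<subseteq> A"
      proof
        fix z assume "z \<in> \<sigma> ` A"
        then obtain \<tau> where \<tau>: "\<tau> \<in> G" "z = \<sigma> (\<tau> x)" by (auto simp: A_def)
        obtain \<rho> where \<rho>: "\<rho> \<in> G" "\<forall>x\<in>F. \<rho> x = \<sigma> (\<tau> x)"
          by (rule fixed_field_base_comp[OF G \<sigma> \<tau>(1)])
        have "z = \<rho> x" using \<tau>(2) bspec[OF \<rho>(2) x] by simp
        thus "z \<in> A" using \<rho>(1) by (simp add: A_def)
      qed
      \<comment> \<open>An injective self-map of a finite set is onto, so \<open>\<sigma>\<close>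
        only permutes the linear factors of \<open>P\<close>.\<close>
      hence img: "\<sigma> ` A = A" using inj A(1) by (simp add: endo_inj_surj)
      have "(\<Prod>y\<in>A. [:- \<sigma> y, 1:]) = (\<Prod>y\<in>\<sigma> ` A. [:- y, 1:])"
        using inj by (simp add: prod.reindex)
      thus ?thesis
        using coeff_prod_linear_base_hom[OF F hom A] by (simp add: P_def img)
    qed
    moreover have "Polynomial.coeff P i \<in> F"
    proof -
      have "base_hom F \<iota>" using G \<iota>(1) by (simp add: fixed_field_base_def)
      thus ?thesis using coeff_prod_linear_base_hom[OF F _ A] by (simp add: P_def)
    qed
    ultimately show ?thesis by (intro fixed_field_base_fixed[OF G])
  qed
  \<comment> \<open>All coefficients lie in the base field, so \<open>P\<close> descends to a
    polynomial over \<open>K\<close>; it is the required witness.\<close>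
  hence "map_poly to_ac (map_poly of_ac P) = P"
    by (intro poly_eqI) (simp add: coeff_map_poly to_ac_of_ac)
  thus "\<exists>q :: 'a poly. poly (map_poly to_ac q) x = 0 \<and>
      rsquarefree (map_poly to_ac q) \<and> (\<forall>y. poly (map_poly to_ac q) y = 0 \<longrightarrow> y \<in> F)"
    using rsquarefree_prod_linear[OF A(1)] xA A(2)
    by (intro exI[of _ "map_poly of_ac P"]) (simp add: roots subset_iff flip: P_def)
qed

text \<open>This stands for "generated over \<open>K\<close> by square roots of elements of
  \<open>K\<close>", phrased as the uniqueness property that the commutation argument uses.\<close>

definition determined_on_sqrts :: "'a :: field alg_closure set \<Rightarrow> bool" where
  "determined_on_sqrts F \<longleftrightarrow> (\<forall>f g. base_hom F f \<longrightarrow> base_hom F g \<longrightarrow>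
     (\<forall>s\<in>F. s ^ 2 \<in> base_field \<longrightarrow> f s = g s) \<longrightarrow> (\<forall>x\<in>F. f x = g x))"

lemma base_hom_sqrt:
  assumes "intermediate_field F" "base_hom F f" "s \<in> F" "s ^ 2 \<in> base_field"
  shows "f s = s \<or> f s = - s"
proof -
  have "f s ^ 2 = s ^ 2"
    using assms base_hom_power[OF assms(1-3), of 2] by (auto simp: base_hom_base)
  thus ?thesis by (simp add: power2_eq_iff)
qed

text \<open>Both composites are homomorphisms on \<open>F\<close>. Each automorphism sends a square
  root of an element of \<open>K\<close> to itself or its negative, and such signs commute, so the
  composites agree on these roots and hence on \<open>F\<close>.\<close>

lemma determined_on_sqrts_commute:
  assumes F: "intermediate_field F" and det: "determined_on_sqrts F"
    and \<sigma>: "base_hom F \<sigma>" "\<sigma> ` F = F" and \<tau>: "base_hom F \<tau>" "\<tau> ` F = F" and x: "x \<in> F"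
  shows "\<sigma> (\<tau> x) = \<tau> (\<sigma> x)"
proof -
  have mem: "\<sigma> y \<in> F" "\<tau> y \<in> F" if "y \<in> F" for y using that \<sigma> \<tau> by auto
  have "base_hom F (\<lambda>x. \<sigma> (\<tau> x))" "base_hom F (\<lambda>x. \<tau> (\<sigma> x))"
    using \<sigma>(1) \<tau>(1) mem by (auto simp: base_hom_def)
  moreover have "\<sigma> (\<tau> s) = \<tau> (\<sigma> s)" if "s \<in> F" "s ^ 2 \<in> base_field" for s
    using base_hom_sqrt[OF F \<sigma>(1) that] base_hom_sqrt[OF F \<tau>(1) that]
      base_hom_uminus[OF F \<sigma>(1) that(1)] base_hom_uminus[OF F \<tau>(1) that(1)] by auto
  ultimately show ?thesis using det x unfolding determined_on_sqrts_def by blast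
qed

section \<open>Adjoining one square root of an element of K\<close>

context
  fixes F :: "'a :: field alg_closure set" and s :: "'a alg_closure" and d :: 'a
  assumes two: "(2 :: 'a) \<noteq> 0" and F: "intermediate_field F"
    and s: "s \<notin> F" "s ^ 2 = to_ac d"
begin

private definition F' where "F' = {a + b * s | a b. a \<in> F \<and> b \<in> F}"

private lemma F'I: "a \<in> F \<Longrightarrow> b \<in> F \<Longrightarrow> a + b * s \<in> F'"
  by (auto simp: F'_def)

private lemma F'E:
  assumes "z \<in> F'"
  obtains a b where "z = a + b * s" "a \<in> F" "b \<in> F"
  using assms by (auto simp: F'_def)

private lemma coordinates_unique:
  assumes "a + b * s = a' + b' * s" "a \<in> F" "b \<in> F" "a' \<in> F" "b' \<in> F"
  shows "a = a' \<and> b = b'"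
proof -
  have "b = b'"
  proof (rule ccontr)
    assume "b \<noteq> b'"
    hence "s = (a' - a) / (b - b')" using assms(1) by (simp add: field_simps)
    moreover have "(a' - a) / (b - b') \<in> F" using assms by (intro intermediate_field_closed[OF F])
    ultimately show False using s by simp
  qed
  thus ?thesis using assms(1) by simp
qed

private lemma subset_F': "F \<subseteq> F'" and s_in_F': "s \<in> F'"
  using F'I[of _ 0] F'I[of 0 1] intermediate_field_zero[OF F] intermediate_field_one[OF F] by auto

private lemma mult_F':
  "(a + b * s) * (a' + b' * s) = (a * a' + b * b' * to_ac d) + (a * b' + b * a') * s"
  by (simp add: algebra_simps power2_eq_square flip: s(2))

private lemma intermediate_F': "intermediate_field F'"
proof (rule intermediate_fieldI)
  show "range to_ac \<subseteq> F'" using subset_F' intermediate_field_base_mem[OF F] by auto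
next
  fix x y assume "x \<in> F'" "y \<in> F'"
  then obtain a b a' b' where *: "x = a + b * s" "y = a' + b' * s" "a \<in> F" "b \<in> F" "a' \<in> F" "b' \<in> F"
    by (elim F'E)
  have "x + y = (a + a') + (b + b') * s" using * by (simp add: algebra_simps)
  thus "x + y \<in> F'" by (simp only:) (intro F'I intermediate_field_add[OF F] *)
  show "x * y \<in> F'" unfolding *(1,2) mult_F'
    by (intro F'I intermediate_field_closed[OF F] *)
next
  fix x assume "x \<in> F'"
  then obtain a b where *: "x = a + b * s" "a \<in> F" "b \<in> F" by (elim F'E)
  \<comment> \<open>The norm of \<open>x\<close>, that is, its product with the conjugate
    \<open>a - b * s\<close>. The conjugate is nonzero by uniqueness of coordinates, so dividing it
    by \<open>N\<close> inverts \<open>x\<close>.\<close>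
  define N where "N = a * a - b * b * to_ac d"
  show "inverse x \<in> F'"
  proof (cases "x = 0")
    case True
    thus ?thesis using subset_F' intermediate_field_zero[OF F] by auto
  next
    case False
    have neg: "- b \<in> F" using * by (intro intermediate_field_closed[OF F])
    have "a + - b * s \<noteq> 0"
    proof
      assume "a + - b * s = 0"
      hence "a + - b * s = 0 + 0 * s" by simp
      hence "a = 0 \<and> - b = 0"
        by (rule coordinates_unique) (intro * neg intermediate_field_zero[OF F])+
      thus False using False * by simp
    qed
    moreover have "x * (a + - b * s) = N" unfolding *(1) mult_F' N_def by simp
    ultimately have "N \<noteq> 0" "inverse x = (a + - b * s) / N" using False by (auto simp: field_simps)
    hence inv: "inverse x = a / N + (- b / N) * s" by (simp add: field_simps)
    have "N \<in> F" unfolding N_def by (intro intermediate_field_closed[OF F] *)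
    thus ?thesis
      unfolding inv by (intro F'I intermediate_field_divide[OF F] * neg)
  qed
qed

text \<open>Every \<open>\<sigma>\<close> in \<open>G\<close> fixes \<open>s ^ 2\<close>, which lies
  in \<open>K\<close>, and therefore extends to \<open>F'\<close> in two ways, with \<open>s\<close>
  going to \<open>s\<close> or to \<open>- s\<close>. All these extensions together form the new
  set.\<close>

private lemma fixed_field_F':
  assumes G: "fixed_field_base F G"
  shows "\<exists>G'. fixed_field_base F' G'"
proof -
  \<comment> \<open>The coordinates of \<open>z\<close> with respect to 1 and \<open>s\<close>; the
    description is meaningful on \<open>F'\<close> only, by
    \<open>coordinates_unique\<close>.\<close>
  define A where "A z = (THE a. a \<in> F \<and> (\<exists>b\<in>F. z = a + b * s))" for z
  define B where "B z = (THE b. b \<in> F \<and> (\<exists>a\<in>F. z = a + b * s))" for z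
  have AB: "A (a + b * s) = a" "B (a + b * s) = b" if "a \<in> F" "b \<in> F" for a b
    using that coordinates_unique unfolding A_def B_def by (blast intro!: the_equality)+
  define ext where "ext \<sigma> \<epsilon> z = \<sigma> (A z) + \<epsilon> * \<sigma> (B z) * s" for \<sigma> and \<epsilon> :: "'a alg_closure" and z
  have ext: "ext \<sigma> \<epsilon> (a + b * s) = \<sigma> a + \<epsilon> * \<sigma> b * s" if "a \<in> F" "b \<in> F" for \<sigma> \<epsilon> a b
    using that by (simp add: ext_def AB)
  define G' where "G' = (\<lambda>(\<sigma>, \<epsilon>). ext \<sigma> \<epsilon>) ` (G \<times> {1, -1})"
  have G'I: "ext \<sigma> \<epsilon> \<in> G'" if "\<sigma> \<in> G" "\<epsilon> \<in> {1, -1}" for \<sigma> \<epsilon>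
    unfolding G'_def using that by (intro image_eqI[of _ _ "(\<sigma>, \<epsilon>)"]) simp_all
  have G'D: "\<exists>\<sigma> \<epsilon>. \<rho> = ext \<sigma> \<epsilon> \<and> \<sigma> \<in> G \<and> \<epsilon> \<in> {1, -1}" if "\<rho> \<in> G'" for \<rho>
    using that unfolding G'_def by (elim imageE SigmaE) (simp only: prod.case, blast)
  have hom: "base_hom F \<sigma>" "\<And>x. x \<in> F \<Longrightarrow> \<sigma> x \<in> F" if "\<sigma> \<in> G" for \<sigma>
    using G that by (auto simp: fixed_field_base_def)
  have sign: "\<epsilon> \<in> F" if "\<epsilon> \<in> {1, -1}" for \<epsilon>
    using that intermediate_field_one[OF F] intermediate_field_uminus[OF F] by auto
  note closed = intermediate_field_closed[OF F]
  have ext_hom: "base_hom F' (ext \<sigma> \<epsilon>)" if "\<sigma> \<in> G" "\<epsilon> \<in> {1, -1}" for \<sigma> \<epsilon>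
    unfolding base_hom_def
  proof (intro conjI ballI allI)
    note \<sigma> = hom(1)[OF that(1)]
    fix x y assume "x \<in> F'" "y \<in> F'"
    then obtain a b a' b' where *: "x = a + b * s" "y = a' + b' * s" and
      mem: "a \<in> F" "b \<in> F" "a' \<in> F" "b' \<in> F" by (elim F'E)
    have xy: "x + y = (a + a') + (b + b') * s" using * by (simp add: algebra_simps)
    show "ext \<sigma> \<epsilon> (x + y) = ext \<sigma> \<epsilon> x + ext \<sigma> \<epsilon> y"
      unfolding xy unfolding *
      using mem by (simp only: ext closed base_hom_add[OF \<sigma>]) (simp add: algebra_simps)
    have "\<epsilon> * \<epsilon> = 1" using that by auto
    hence eps: "\<epsilon> * (\<epsilon> * z) = z" for z by (metis mult.assoc mult_1)
    have "ext \<sigma> \<epsilon> (x * y) =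
        \<sigma> a * \<sigma> a' + \<sigma> b * \<sigma> b' * to_ac d + \<epsilon> * (\<sigma> a * \<sigma> b' + \<sigma> b * \<sigma> a') * s"
      unfolding * mult_F'
      using mem by (simp add: ext closed base_hom_add[OF \<sigma>] base_hom_mult[OF \<sigma>] base_hom_base[OF \<sigma>])
    also have "\<dots> = (\<sigma> a + \<epsilon> * \<sigma> b * s) * (\<sigma> a' + \<epsilon> * \<sigma> b' * s)"
      unfolding mult_F' using \<open>\<epsilon> * \<epsilon> = 1\<close> by (simp add: algebra_simps eps)
    finally show "ext \<sigma> \<epsilon> (x * y) = ext \<sigma> \<epsilon> x * ext \<sigma> \<epsilon> y"
      unfolding * using mem by (simp add: ext)
  next
    fix c
    show "ext \<sigma> \<epsilon> (to_ac c) = to_ac c"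
      using ext[of "to_ac c" 0 \<sigma> \<epsilon>] hom(1)[OF that(1)]
      by (simp add: closed base_hom_base base_hom_zero)
  qed
  have ext_image: "ext \<sigma> \<epsilon> ` F' \<subseteq> F'" if "\<sigma> \<in> G" "\<epsilon> \<in> {1, -1}" for \<sigma> \<epsilon>
  proof
    fix z assume "z \<in> ext \<sigma> \<epsilon> ` F'"
    then obtain a b where "z = \<sigma> a + (\<epsilon> * \<sigma> b) * s" "a \<in> F" "b \<in> F"
      by (auto elim!: F'E simp: ext)
    thus "z \<in> F'"
      using hom(2)[OF that(1)] sign[OF that(2)] by (simp only: F'I intermediate_field_mult[OF F])
  qed
  have ext_comp: "\<exists>\<rho>\<in>G'. \<forall>x\<in>F'. \<rho> x = ext \<sigma> \<epsilon> (ext \<tau> \<delta> x)"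
    if st: "\<sigma> \<in> G" "\<epsilon> \<in> {1, -1}" "\<tau> \<in> G" "\<delta> \<in> {1, -1}" for \<sigma> \<epsilon> \<tau> \<delta>
  proof -
    obtain \<rho> where \<rho>: "\<rho> \<in> G" "\<forall>x\<in>F. \<rho> x = \<sigma> (\<tau> x)"
      by (rule fixed_field_base_comp[OF G st(1,3)])
    have "ext \<rho> (\<epsilon> * \<delta>) x = ext \<sigma> \<epsilon> (ext \<tau> \<delta> x)" if "x \<in> F'" for x
    proof -
      obtain a b where x: "x = a + b * s" "a \<in> F" "b \<in> F" using \<open>x \<in> F'\<close> by (rule F'E)
      \<comment> \<open>Since \<open>\<sigma>\<close> commutes with the sign
        \<open>\<delta>\<close>, the signs of two extensions multiply under composition.\<close>
      have "\<sigma> (\<delta> * \<tau> b) = \<delta> * \<sigma> (\<tau> b)"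
        using st(4) base_hom_uminus[OF F hom(1)[OF st(1)] hom(2)[OF st(3) x(3)]] by auto
      thus ?thesis
        using x hom(2)[OF st(3)] sign[OF st(4)] by (simp add: ext \<rho> closed del: mult.assoc)
    qed
    moreover have "ext \<rho> (\<epsilon> * \<delta>) \<in> G'" using \<rho>(1) st by (intro G'I) auto
    ultimately show ?thesis by blast
  qed
  obtain \<iota> where \<iota>: "\<iota> \<in> G" "\<forall>x\<in>F. \<iota> x = x"
    using G by (rule fixed_field_base_id)
  have ext_id: "ext \<iota> 1 x = x" if "x \<in> F'" for x
    using that \<iota> by (auto elim!: F'E simp: ext)
  have ext_fixed: "x \<in> base_field" if x: "x \<in> F'" "\<And>\<sigma> \<epsilon>. \<sigma> \<in> G \<Longrightarrow> \<epsilon> \<in> {1, -1} \<Longrightarrow> ext \<sigma> \<epsilon> x = x" for x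
  proof -
    obtain a b where ab: "x = a + b * s" "a \<in> F" "b \<in> F" using x(1) by (elim F'E)
    \<comment> \<open>The extension of the identity that negates \<open>s\<close> forces
      \<open>b = - b\<close>. As 2 is nonzero, \<open>b\<close> vanishes, and invariance of
      \<open>a\<close> under \<open>G\<close> finishes the argument.\<close>
    have "a + (- b) * s = a + b * s"
      using x(2)[of \<iota> "-1"] \<iota> ab by (simp add: ext)
    hence "a = a \<and> - b = b"
      by (rule coordinates_unique) (intro ab closed)+
    hence neg: "- b = b" by (rule conjunct2)
    have "b + b = - b + b" unfolding neg by (rule refl)
    moreover have "to_ac 2 * b = b + b" unfolding to_ac_numeral by (rule mult_2)
    ultimately have "to_ac 2 * b = 0" by (simp only: add.left_inverse)
    hence b: "b = 0" using two unfolding mult_eq_0_iff to_ac_eq_0_iff by simp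
    have "\<sigma> a = a" if "\<sigma> \<in> G" for \<sigma>
      using x(2)[OF that, of 1] ab b ext[OF ab(2) intermediate_field_zero[OF F]]
        base_hom_zero[OF hom(1)[OF that]] by simp
    hence "a \<in> base_field" by (rule fixed_field_base_fixed[OF G ab(2)])
    thus ?thesis using ab b by simp
  qed
  have "fixed_field_base F' G'"
    unfolding fixed_field_base_def
  proof (intro conjI ballI impI)
    show "finite G'" using G by (simp add: G'_def fixed_field_base_def)
    show "base_hom F' \<rho>" "\<rho> ` F' \<subseteq> F'" if "\<rho> \<in> G'" for \<rho>
      using G'D[OF that] ext_hom ext_image by (elim exE conjE; simp only:)+
    show "\<exists>\<rho>\<in>G'. \<forall>x\<in>F'. \<rho> x = \<sigma>' (\<tau>' x)" if \<sigma>': "\<sigma>' \<in> G'" and \<tau>': "\<tau>' \<in> G'" for \<sigma>' \<tau>'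
    proof -
      obtain \<sigma> \<epsilon> where 1: "\<sigma>' = ext \<sigma> \<epsilon>" "\<sigma> \<in> G" "\<epsilon> \<in> {1, -1}" using G'D[OF \<sigma>'] by (elim exE conjE)
      obtain \<tau> \<delta> where 2: "\<tau>' = ext \<tau> \<delta>" "\<tau> \<in> G" "\<delta> \<in> {1, -1}" using G'D[OF \<tau>'] by (elim exE conjE)
      show ?thesis unfolding 1(1) 2(1) by (rule ext_comp[OF 1(2,3) 2(2,3)])
    qed
    show "\<exists>\<rho>\<in>G'. \<forall>x\<in>F'. \<rho> x = x"
      by (rule bexI[OF _ G'I[OF \<iota>(1), of 1]]) (simp_all add: ext_id)
    show "x \<in> base_field" if "x \<in> F'" "\<forall>\<rho>\<in>G'. \<rho> x = x" for x
      by (rule ext_fixed[OF that(1)]) (rule bspec[OF that(2) G'I])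
  qed
  thus ?thesis ..
qed

text \<open>The new generator \<open>s\<close> is itself a square root of an element of
  \<open>K\<close>, so two homomorphisms that agree on all such roots agree on \<open>F\<close> and
  on \<open>s\<close>.\<close>

private lemma determined_F':
  assumes "determined_on_sqrts F"
  shows "determined_on_sqrts F'"
  unfolding determined_on_sqrts_def
proof (intro allI impI ballI)
  fix f g x assume fg: "base_hom F' f" "base_hom F' g"
    "\<forall>s\<in>F'. s ^ 2 \<in> base_field \<longrightarrow> f s = g s" and x: "x \<in> F'"
  have "base_hom F h" if "base_hom F' h" for h
    using that subset_F' unfolding base_hom_def by (meson subsetD)
  with fg(1,2) have "base_hom F f" "base_hom F g" by auto
  moreover have "\<forall>s\<in>F. s ^ 2 \<in> base_field \<longrightarrow> f s = g s" using fg(3) subset_F' by blast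
  ultimately have eq: "f x = g x" if "x \<in> F" for x
    using assms that unfolding determined_on_sqrts_def by blast
  obtain a b where ab: "x = a + b * s" "a \<in> F" "b \<in> F" using x by (elim F'E)
  have mem: "a \<in> F'" "b \<in> F'" "b * s \<in> F'"
    using ab subset_F' s_in_F' intermediate_field_mult[OF intermediate_F'] by auto
  have "f s = g s" using fg(3) s_in_F' s(2) by auto
  thus "f x = g x"
    unfolding ab(1) using eq ab(2,3) mem s_in_F' fg(1,2)
    by (simp add: base_hom_add[of F'] base_hom_mult[of F'])
qed

private lemma base_span_F': "base_span (us @ map ((*) s) us) = F'" if "base_span us = F"
  unfolding base_span_append base_span_mult that F'_def by (force simp: mult.commute)

text \<open>The new field is handed over by a spanning list, so that the invariant of the induction
  below can be iterated.\<close>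

lemma adjoin_sqrt:
  assumes "F = base_span us" "fixed_field_base F G" "determined_on_sqrts F"
  obtains us' G' where "intermediate_field (base_span us')" "fixed_field_base (base_span us') G'"
    "determined_on_sqrts (base_span us')" "F \<subseteq> base_span us'" "s \<in> base_span us'"
proof -
  obtain G' where "fixed_field_base F' G'" using fixed_field_F'[OF assms(2)] by blast
  thus ?thesis
    using that[of "us @ map ((*) s) us" G'] base_span_F'[OF assms(1)[symmetric]]
      intermediate_F' determined_F'[OF assms(3)] subset_F' s_in_F' by simp
qed

end

lemma base_span_one: "base_span [1] = (base_field :: 'a :: field alg_closure set)"
  by (auto simp: base_span_Cons base_span_Nil)

text \<open>Induction on \<open>ds\<close>; the spanning list records finite degree,
  \<open>G\<close> gives separability and normality, and \<open>determined_on_sqrts\<close> gives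
  commutation. Both roots of each radicand are included, since one is the negative of the
  other.\<close>

lemma multiquadratic_extension:
  assumes two: "(2 :: 'a :: field) \<noteq> 0"
  shows "\<exists>us G. intermediate_field (base_span us) \<and> fixed_field_base (base_span us) G \<and>
     determined_on_sqrts (base_span us) \<and>
     (\<forall>d\<in>set ds. \<forall>s. s ^ 2 = to_ac (d :: 'a) \<longrightarrow> s \<in> base_span us)"
proof (induction ds)
  case Nil
  have "fixed_field_base (base_field :: 'a alg_closure set) {\<lambda>x. x}"
    by (auto simp: fixed_field_base_def base_hom_def)
  moreover have "determined_on_sqrts (base_field :: 'a alg_closure set)"
    by (auto simp: determined_on_sqrts_def base_hom_base)
  ultimately show ?case
    using intermediate_field_base by (intro exI[of _ "[1]"]) (auto simp: base_span_one)
next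
  case (Cons d ds)
  then obtain us G where F: "intermediate_field (base_span us)" "fixed_field_base (base_span us) G"
    "determined_on_sqrts (base_span us)"
    and sq: "\<And>d s. d \<in> set ds \<Longrightarrow> s ^ 2 = to_ac d \<Longrightarrow> s \<in> base_span us"
    by blast
  obtain s where s: "s ^ 2 = to_ac d" using nth_root_exists[of 2 "to_ac d"] by auto
  have roots: "t = s \<or> t = - s" if "t ^ 2 = to_ac d" for t
    using that s by (metis power2_eq_iff)
  obtain us' G' where F': "intermediate_field (base_span us')" "fixed_field_base (base_span us') G'"
    "determined_on_sqrts (base_span us')" "base_span us \<subseteq> base_span us'" "s \<in> base_span us'"
  \<comment> \<open>Uniqueness of coordinates requires \<open>s\<close> to lie outside the field; if
    it lies inside, the field is kept unchanged.\<close>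
  proof (cases "s \<in> base_span us")
    case True
    thus ?thesis using that F by blast
  next
    case False
    from adjoin_sqrt[OF two F(1) this s refl F(2,3)] that show ?thesis by blast
  qed
  have "t \<in> base_span us'" if "t ^ 2 = to_ac d" for t
    using roots[OF that] F'(5) intermediate_field_uminus[OF F'(1)] by auto
  hence "\<forall>e\<in>set (d # ds). \<forall>t. t ^ 2 = to_ac e \<longrightarrow> t \<in> base_span us'"
    using sq F'(4) by auto
  with F'(1-3) show ?case by blast
qed

section \<open>Finite base fields\<close>

lemma rsquarefree_if_pderiv:
  fixes p :: "'a :: idom poly"
  assumes "p \<noteq> 0" "\<And>a. poly p a = 0 \<Longrightarrow> poly (pderiv p) a \<noteq> 0"
  shows "rsquarefree p"
proof -
  have "Polynomial.order a p \<le> 1" for a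
  proof (rule ccontr)
    assume "\<not> Polynomial.order a p \<le> 1"
    hence "[:- a, 1:] ^ 2 dvd p" by (simp add: order_divides)
    then obtain r where "p = [:- a, 1:] ^ 2 * r" by (auto elim: dvdE)
    moreover define l where "l = [:- a, 1:]"
    ultimately have "p = l * (l * r)" by (simp only: power2_eq_square mult.assoc)
    moreover have "poly l a = 0" by (simp add: l_def)
    ultimately have "poly p a = 0 \<and> poly (pderiv p) a = 0" by (simp add: pderiv_mult)
    thus False using assms(2) by blast
  qed
  thus ?thesis using assms(1) by (simp add: rsquarefree_def le_Suc_eq)
qed

text \<open>Over an algebraically closed field the multiset of roots has as many members as the
  degree; squarefreeness makes it a set.\<close>

lemma card_roots_rsquarefree:
  fixes p :: "'a :: alg_closed_field poly"
  assumes "rsquarefree p"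
  shows "card {x. poly p x = 0} = Polynomial.degree p"
proof -
  have nz: "p \<noteq> 0" using assms by (simp add: rsquarefree_def)
  then obtain A where A: "size A = Polynomial.degree p"
    "p = Polynomial.smult (Polynomial.lead_coeff p) (\<Prod>x\<in>#A. [:- x, 1:])"
    using alg_closed_imp_factorization by blast
  have "proots p = proots (\<Prod>x\<in>#A. [:- x, 1:])"
    using nz by (subst A(2)) simp
  also have "\<dots> = A"
    using proots_prod_mset[of "image_mset (\<lambda>x. [:- x, 1:]) A"] by (simp add: multiset.map_comp comp_def image_iff)
  finally have count: "count A x = Polynomial.order x p" for x using nz by (metis count_proots)
  have "set_mset A = {x. poly p x = 0}"
    using nz by (auto simp: set_eq_iff count order_root simp flip: count_greater_zero_iff)
  moreover have "A = mset_set (set_mset A)"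
  proof (rule multiset_eqI)
    fix x
    have "count A x = 0 \<or> count A x = 1" using assms by (simp add: count rsquarefree_def)
    thus "count A x = count (mset_set (set_mset A)) x"
      by (auto simp: count_mset_set' simp flip: count_greater_zero_iff)
  qed
  hence "size A = card (set_mset A)" by (metis size_mset_set)
  ultimately show ?thesis using A(1) by simp
qed

text \<open>By pigeonhole two iterates coincide, and injectivity cancels the smaller one.\<close>

lemma bij_finite_funpow_id:
  fixes f :: "'a \<Rightarrow> 'a"
  assumes "finite (UNIV :: 'a set)" "inj f"
  shows "\<exists>m>0. \<forall>x. (f ^^ m) x = x"
proof -
  have "finite (UNIV :: ('a \<Rightarrow> 'a) set)"
    using finite_set_of_finite_funs[OF assms(1) assms(1)] by simp
  hence "finite (range (\<lambda>i. f ^^ i))" by (rule finite_subset[OF subset_UNIV])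
  hence "\<not> inj (\<lambda>i. f ^^ i)" using finite_imageD[of "\<lambda>i. f ^^ i" UNIV] by auto
  then obtain i j where "f ^^ i = f ^^ j" "i < j"
    unfolding inj_def by (metis linorder_neqE_nat)
  hence "(f ^^ i) ((f ^^ (j - i)) x) = (f ^^ i) x" for x
    by (metis funpow_add le_add_diff_inverse less_imp_le_nat o_apply)
  moreover have "inj (f ^^ i)" using assms(2) by (rule inj_fn)
  ultimately show ?thesis using \<open>i < j\<close> by (intro exI[of _ "j - i"]) (auto dest: injD)
qed

text \<open>The Frobenius map is injective by the freshman's dream, so some positive iterate of it
  is the identity. The resulting \<open>m\<close> says that \<open>K\<close> lies in the field with
  p^m elements, where p is the characteristic.\<close>

lemma finite_field_frobenius_power:
  assumes "finite (UNIV :: 'a :: field set)"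
  shows "\<exists>m>0. \<forall>x :: 'a. x ^ (CHAR('a) ^ m) = x"
proof -
  have p: "prime CHAR('a)" using assms finite_imp_CHAR_pos prime_CHAR_semidom by blast
  let ?f = "\<lambda>x :: 'a. x ^ CHAR('a)"
  have "inj ?f"
  proof (rule injI)
    fix x y :: 'a assume "x ^ CHAR('a) = y ^ CHAR('a)"
    moreover have "((x - y) + y) ^ CHAR('a) = (x - y) ^ CHAR('a) + y ^ CHAR('a)"
      by (rule freshmans_dream[OF p refl])
    ultimately have "(x - y) ^ CHAR('a) = 0" by simp
    thus "x = y" by simp
  qed
  moreover have "(?f ^^ m) x = x ^ (CHAR('a) ^ m)" for m x
    by (induction m) (simp_all add: power_mult[symmetric] mult.commute)
  ultimately show ?thesis using bij_finite_funpow_id[OF assms, of ?f] by simp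
qed

section \<open>Fixed fields of Frobenius powers\<close>

context
  fixes m :: nat
  assumes fin: "finite (UNIV :: 'a :: field set)"
    and m: "m > 0" "\<And>x :: 'a. x ^ (CHAR('a) ^ m) = x"
begin

private lemma prime_char: "prime CHAR('a)"
  using fin finite_imp_CHAR_pos prime_CHAR_semidom by blast

text \<open>For positive \<open>k\<close> this is the field with p^(m k) elements, p being the
  characteristic; the factor \<open>m\<close> in the exponent ensures that it contains
  \<open>K\<close>.\<close>

definition frobenius_fixed :: "nat \<Rightarrow> 'a alg_closure set" where
  "frobenius_fixed k = {x. x ^ (CHAR('a) ^ (m * k)) = x}"

lemma intermediate_frobenius_fixed: "intermediate_field (frobenius_fixed k)"
proof (rule intermediate_fieldI)
  have "c ^ (CHAR('a) ^ (m * k)) = c" for c :: 'a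
    by (induction k) (simp_all add: power_add power_mult m(2))
  thus "range to_ac \<subseteq> frobenius_fixed k" by (auto simp: frobenius_fixed_def simp flip: to_ac_power)
next
  fix x y assume xy: "x \<in> frobenius_fixed k" "y \<in> frobenius_fixed k"
  have "prime CHAR('a alg_closure)" using prime_char by simp
  from freshmans_dream'[OF this refl] xy show "x + y \<in> frobenius_fixed k"
    by (simp add: frobenius_fixed_def)
  show "x * y \<in> frobenius_fixed k" using xy by (simp add: frobenius_fixed_def power_mult_distrib)
next
  fix x assume "x \<in> frobenius_fixed k"
  thus "inverse x \<in> frobenius_fixed k" by (simp add: frobenius_fixed_def power_inverse)
qed

text \<open>The polynomial X^q - X with q = p^(m k). The coefficient field is left open so that it
  can be read both over \<open>K\<close> and over the closure.\<close>

private definition frob_poly :: "nat \<Rightarrow> 'b :: field poly" where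
  "frob_poly k = Polynomial.monom 1 (CHAR('a) ^ (m * k)) - Polynomial.monom 1 1"

private lemma char_power_gt_1: "k > 0 \<Longrightarrow> CHAR('a) ^ (m * k) > 1"
  using m(1) prime_gt_1_nat[OF prime_char] by (intro one_less_power) auto

private lemma degree_frob_poly:
  assumes "k > 0"
  shows "Polynomial.degree (frob_poly k :: 'b :: field poly) = CHAR('a) ^ (m * k)"
proof -
  have "Polynomial.degree (- Polynomial.monom 1 1 + Polynomial.monom 1 (CHAR('a) ^ (m * k)) :: 'b poly)
      = Polynomial.degree (Polynomial.monom 1 (CHAR('a) ^ (m * k)) :: 'b poly)"
    using char_power_gt_1[OF assms] by (intro degree_add_eq_right) (simp add: degree_monom_eq)
  thus ?thesis by (simp add: frob_poly_def degree_monom_eq)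
qed

text \<open>The exponent is divisible by the characteristic, so the derivative is the constant -1
  and has no roots.\<close>

private lemma rsquarefree_frob_poly:
  assumes "k > 0"
  shows "rsquarefree (frob_poly k :: 'a alg_closure poly)"
proof (rule rsquarefree_if_pderiv)
  show "frob_poly k \<noteq> (0 :: 'a alg_closure poly)"
    using degree_frob_poly[OF assms, where ?'b = "'a alg_closure"] prime_gt_0_nat[OF prime_char] by auto
  have "CHAR('a alg_closure) dvd CHAR('a) ^ (m * k)"
    using m(1) assms by (simp add: dvd_power)
  hence "(of_nat (CHAR('a) ^ (m * k)) :: 'a alg_closure) = 0"
    by (simp only: of_nat_eq_0_iff_char_dvd)
  thus "poly (pderiv (frob_poly k)) a \<noteq> 0" for a :: "'a alg_closure"
    using m(1) assms by (simp add: frob_poly_def pderiv_diff pderiv_monom poly_monom zero_power)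
qed

private lemma frobenius_fixed_roots: "frobenius_fixed k = {x. poly (frob_poly k) x = 0}"
  by (simp add: frobenius_fixed_def frob_poly_def poly_monom)

lemma card_frobenius_fixed: "k > 0 \<Longrightarrow> card (frobenius_fixed k) = CHAR('a) ^ (m * k)"
  unfolding frobenius_fixed_roots
  by (simp add: card_roots_rsquarefree rsquarefree_frob_poly degree_frob_poly)

lemma finite_frobenius_fixed: "k > 0 \<Longrightarrow> finite (frobenius_fixed k)"
  using card_frobenius_fixed[of k] prime_gt_0_nat[OF prime_char] by (intro card_ge_0_finite) simp

lemma split_frobenius_fixed:
  assumes "k > 0"
  shows "split_by_squarefree (frobenius_fixed k)"
proof -
  have "map_poly to_ac (frob_poly k :: 'a poly) = frob_poly k"
    by (intro poly_eqI) (simp add: frob_poly_def coeff_map_poly)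
  thus ?thesis
    unfolding split_by_squarefree_def
    using rsquarefree_frob_poly[OF assms]
    by (intro ballI exI[of _ "frob_poly k"]) (simp add: frobenius_fixed_roots)
qed

lemma finite_degree_frobenius_fixed:
  assumes "k > 0"
  shows "finite_degree_extension (frobenius_fixed k)"
proof -
  obtain us where us: "set us = frobenius_fixed k"
    using finite_list[OF finite_frobenius_fixed[OF assms]] by blast
  have "base_span us = frobenius_fixed k"
    using base_span_superset[of us] base_span_least[OF intermediate_frobenius_fixed, of us k] us
    by (simp del: ring.Span.simps)
  thus ?thesis
    using finite_degree_extension_base_span[of us] intermediate_frobenius_fixed[of k] by simp
qed

text \<open>The multiplicative group is cyclic, say generated by \<open>g\<close>. An automorphism
  sends \<open>g\<close> to a power of \<open>g\<close>, hence acts on nonzero elements by raising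
  to a fixed exponent, and such power maps commute.\<close>

lemma solvable_frobenius_fixed:
  assumes "k > 0"
  shows "solvable_extension (frobenius_fixed k)"
proof (rule solvable_extensionI[OF intermediate_frobenius_fixed split_frobenius_fixed[OF assms]])
  define F where "F = frobenius_fixed k"
  have F: "intermediate_field F" unfolding F_def by (rule intermediate_frobenius_fixed)
  obtain g where g: "g \<in> F" "g \<noteq> 0" "\<And>x. x \<in> F \<Longrightarrow> x \<noteq> 0 \<Longrightarrow> \<exists>i. x = g ^ i"
  proof -
    interpret R: field "closure_ring :: 'a alg_closure ring" by (rule field_from_type_algebra)
    let ?R = "closure_ring \<lparr> carrier := F \<rparr>"
    have "subfield F closure_ring" using F by (simp add: intermediate_field_def)
    hence "field ?R" by (rule R.subfield_iff(2))
    moreover have "finite (carrier ?R)" using finite_frobenius_fixed[OF assms] by (simp add: F_def)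
    ultimately obtain g where g: "g \<in> carrier (Multiplicative_Group.mult_of ?R)"
      "carrier (Multiplicative_Group.mult_of ?R) = {g [^]\<^bsub>?R\<^esub> i | i :: nat. i \<in> UNIV}"
      using field.finite_field_mult_group_has_gen by blast
    have "g [^]\<^bsub>?R\<^esub> (i :: nat) = g ^ i" for i
      by (induction i) (simp_all add: nat_pow_def ring_of_type_algebra_def)
    hence "F - {0} = {g ^ i | i. True}" "g \<in> F" "g \<noteq> 0"
      using g by (simp_all add: Multiplicative_Group.carrier_mult_of)
    thus ?thesis by (intro that[of g]) blast+
  qed
  fix \<sigma> \<tau> x
  assume "base_hom (frobenius_fixed k) \<sigma>" "base_hom (frobenius_fixed k) \<tau>"
    "\<sigma> ` frobenius_fixed k = frobenius_fixed k" "\<tau> ` frobenius_fixed k = frobenius_fixed k"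
    "x \<in> frobenius_fixed k"
  hence hom: "base_hom F \<sigma>" "base_hom F \<tau>" and img: "\<sigma> ` F = F" "\<tau> ` F = F" and x: "x \<in> F"
    by (simp_all add: F_def)
  show "\<sigma> (\<tau> x) = \<tau> (\<sigma> x)"
  proof (cases "x = 0")
    case True
    thus ?thesis using hom by (simp add: base_hom_zero)
  next
    case False
    have "\<exists>i. \<rho> g = g ^ i" if \<rho>: "base_hom F \<rho>" "\<rho> ` F = F" for \<rho>
    proof (rule g(3))
      show "\<rho> g \<in> F" using \<rho>(2) g(1) by blast
      show "\<rho> g \<noteq> 0"
        using base_hom_inj[OF F \<rho>(1)] base_hom_zero[OF \<rho>(1)] g(1,2) intermediate_field_zero[OF F]
        by (metis inj_onD)
    qed
    from this[OF hom(1) img(1)] this[OF hom(2) img(2)]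
    obtain a b where ab: "\<sigma> g = g ^ a" "\<tau> g = g ^ b" by blast
    obtain i where i: "x = g ^ i" using g(3)[OF x False] by blast
    have "\<sigma> (\<tau> x) = g ^ (a * (b * i))" "\<tau> (\<sigma> x) = g ^ (b * (a * i))"
      unfolding i using g(1) F
      by (simp_all add: base_hom_power[OF F hom(1)] base_hom_power[OF F hom(2)] ab
          intermediate_field_power flip: power_mult)
    thus ?thesis by (simp add: mult.left_commute)
  qed
qed

text \<open>With q the size of the smaller field, a nonzero \<open>s ^ 2\<close> has order dividing
  q - 1. As q is odd, q + 1 is even, so \<open>s\<close> raised to (q - 1)(q + 1) is 1. Doubling
  \<open>k\<close> squares q, and one field thus receives all the square roots at once.\<close>

lemma sqrt_in_frobenius_fixed:
  assumes odd: "odd CHAR('a)" and s: "s ^ 2 \<in> frobenius_fixed k"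
  shows "s \<in> frobenius_fixed (2 * k)"
proof (cases "s = 0")
  case True
  thus ?thesis using intermediate_field_zero[OF intermediate_frobenius_fixed] by simp
next
  case False
  define N where "N = CHAR('a) ^ (m * k)"
  have "odd N" using odd by (simp add: N_def)
  then obtain j where j: "N = Suc (2 * j)" by (metis oddE Suc_eq_plus1)
  have "s ^ 2 * (s ^ 2) ^ (2 * j) = s ^ 2 * 1"
    using s by (simp add: frobenius_fixed_def flip: N_def) (simp add: j)
  hence one: "(s ^ 2) ^ (2 * j) = 1" using False by (simp only: mult_cancel_left) simp
  \<comment> \<open>Here \<open>2 * j\<close> is N - 1 and \<open>j + 1\<close> is half of N +
    1.\<close>
  have "N * N = Suc (2 * (2 * j * (j + 1)))" by (simp add: j algebra_simps)
  hence "s ^ (N * N) = s * ((s ^ 2) ^ (2 * j)) ^ (j + 1)"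
    by (simp only: power_Suc power_mult)
  hence "s ^ (N * N) = s" using one by simp
  moreover have "CHAR('a) ^ (m * (2 * k)) = N * N"
    by (simp add: N_def mult_2 distrib_left power_add)
  ultimately show ?thesis by (simp add: frobenius_fixed_def)
qed

end

section \<open>Points with prescribed abscissae\<close>

text \<open>One point is chosen above each abscissa in \<open>A\<close>, and points with different
  abscissae differ. The infinite case is kept apart because \<open>card\<close> is then 0.\<close>

lemma card_rational_points:
  fixes E :: "'a :: field weierstrass"
  defines "C \<equiv> base_change to_ac E"
  assumes two: "(2 :: 'a) \<noteq> 0" and F: "intermediate_field F"
    and A: "A \<subseteq> F"
    and sqrt: "\<And>x s. x \<in> A \<Longrightarrow>
      s ^ 2 = (a1 C * x + a3 C) ^ 2 + 4 * (x ^ 3 + a2 C * x ^ 2 + a4 C * x + a6 C) \<Longrightarrow> s \<in> F"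
  shows "infinite (rational_points E F) \<or> card (rational_points E F) \<ge> card A"
proof (cases "finite (rational_points E F)")
  case True
  have C: "a1 C \<in> F" "a3 C \<in> F"
    using intermediate_field_base_mem[OF F] by (simp_all add: C_def base_change_def)
  have two': "(2 :: 'a alg_closure) \<noteq> 0"
    using two to_ac_eq_0_iff[of "2 :: 'a"] by simp
  have "\<exists>y\<in>F. on_curve C x y" if x: "x \<in> A" for x
  proof -
    define u where "u = a1 C * x + a3 C"
    obtain s where s: "s ^ 2 = u ^ 2 + 4 * (x ^ 3 + a2 C * x ^ 2 + a4 C * x + a6 C)"
      using nth_root_exists[of 2] by (metis zero_less_numeral)
    have "s \<in> F" using sqrt[OF x] s by (simp add: u_def)
    \<comment> \<open>The quadratic formula for \<open>y ^ 2 + u * y\<close>, with \<open>s\<close>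
      a square root of its discriminant.\<close>
    moreover define y where "y = (s - u) / 2"
    ultimately have "y \<in> F"
      unfolding y_def u_def using x A C by (auto intro!: intermediate_field_closed[OF F])
    have "s = 2 * y + u" using two' by (simp add: y_def)
    hence "4 * (y ^ 2 + u * y) = 4 * (x ^ 3 + a2 C * x ^ 2 + a4 C * x + a6 C)"
      using s by (simp add: power2_eq_square algebra_simps)
    moreover have "(4 :: 'a alg_closure) \<noteq> 0"
      using two' no_zero_divisors[of "2 :: 'a alg_closure" 2] by simp
    ultimately have "y ^ 2 + u * y = x ^ 3 + a2 C * x ^ 2 + a4 C * x + a6 C"
      by (simp only: mult_cancel_left) simp
    hence "on_curve C x y" by (simp add: on_curve_def u_def algebra_simps)
    with \<open>y \<in> F\<close> show ?thesis by blast
  qed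
  then obtain y where y: "\<And>x. x \<in> A \<Longrightarrow> y x \<in> F \<and> on_curve C x (y x)" by metis
  have "(\<lambda>x. Affine x (y x)) ` A \<subseteq> rational_points E F"
    using y A by (auto simp: rational_points_def C_def)
  moreover have "inj_on (\<lambda>x. Affine x (y x)) A" by (auto simp: inj_on_def)
  ultimately show ?thesis using True by (metis card_image card_mono)
qed simp

theorem theorem2p13:
  fixes E :: "'a :: field weierstrass" and n :: nat
  assumes "(6 :: 'a) \<noteq> 0"
    and "elliptic_curve E"
    and "n \<ge> 4" and "even n" and "\<not> CHAR('a) dvd n"
  shows "\<exists>K'. finite_degree_extension K' \<and> solvable_extension K' \<and>
           (infinite (rational_points E K') \<or> card (rational_points E K') \<ge> 2 * n)"
proof -
  have two: "(2 :: 'a) \<noteq> 0"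
  proof
    assume "(2 :: 'a) = 0"
    moreover have "(6 :: 'a) = 2 * 3" by simp
    ultimately show False using assms(1) by simp
  qed
  define C where "C = base_change to_ac E"
  show ?thesis
  proof (cases "finite (UNIV :: 'a set)")
    case False
    then obtain A :: "'a set" where A: "finite A" "card A = 2 * n"
      using infinite_arbitrarily_large by blast
    \<comment> \<open>The radicands are formed over \<open>K\<close> itself, as the multiquadratic
      construction requires.\<close>
    define D where "D x = (a1 E * x + a3 E) ^ 2 + 4 * (x ^ 3 + a2 E * x ^ 2 + a4 E * x + a6 E)" for x
    obtain xs where xs: "set xs = A" using finite_list[OF A(1)] by blast
    obtain us G where F: "intermediate_field (base_span us)" "fixed_field_base (base_span us) G"
      "determined_on_sqrts (base_span us)"
      and sqrt: "\<And>d s. d \<in> set (map D xs) \<Longrightarrow> s ^ 2 = to_ac d \<Longrightarrow> s \<in> base_span us"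
      using multiquadratic_extension[OF two, of "map D xs"] by blast
    have "finite_degree_extension (base_span us)"
      by (rule finite_degree_extension_base_span[OF F(1)])
    moreover have "solvable_extension (base_span us)"
      using determined_on_sqrts_commute[OF F(1,3)]
      by (intro solvable_extensionI[OF F(1) fixed_field_base_imp_split[OF F(1,2)]])
    moreover have "infinite (rational_points E (base_span us)) \<or>
        card (rational_points E (base_span us)) \<ge> card (to_ac ` A)"
    proof (rule card_rational_points[OF two F(1)])
      show "to_ac ` A \<subseteq> base_span us" using intermediate_field_base_mem[OF F(1)] by auto
      fix x s
      assume "x \<in> to_ac ` A"
      then obtain x' where x': "x' \<in> A" "x = to_ac x'" by blast
      assume "s ^ 2 = (a1 (base_change to_ac E) * x + a3 (base_change to_ac E)) ^ 2 +
        4 * (x ^ 3 + a2 (base_change to_ac E) * x ^ 2 + a4 (base_change to_ac E) * x +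
          a6 (base_change to_ac E))"
      hence "s ^ 2 = to_ac (D x')" by (simp add: D_def x' base_change_def)
      thus "s \<in> base_span us" using sqrt[of "D x'"] x' xs by simp
    qed
    moreover have "card (to_ac ` A) = 2 * n"
      using A card_image[OF inj_on_subset[OF inj_to_ac subset_UNIV[of A]]] by simp
    ultimately show ?thesis by (intro exI[of _ "base_span us"]) (simp del: ring.Span.simps)
  next
    case True
    then obtain m where m: "m > 0" "\<And>x :: 'a. x ^ (CHAR('a) ^ m) = x"
      using finite_field_frobenius_power by blast
    note frob = True m
    have prime: "prime CHAR('a)" using True finite_imp_CHAR_pos prime_CHAR_semidom by blast
    have "CHAR('a) \<noteq> 2" using two by (metis of_nat_CHAR of_nat_numeral)
    hence odd: "odd CHAR('a)" using prime prime_odd_nat prime_ge_2_nat by (metis le_neq_implies_less)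
    \<comment> \<open>Abscissae are taken in \<open>?M\<close>, points in its quadratic extension
      \<open>?F\<close>. The parameter 2n is a crude choice that suffices because 2^k exceeds
      k.\<close>
    let ?M = "frobenius_fixed m (2 * n) :: 'a alg_closure set"
    let ?F = "frobenius_fixed m (2 * (2 * n)) :: 'a alg_closure set"
    have pos: "2 * n > 0" "2 * (2 * n) > 0" using assms(3) by simp_all
    have F0: "intermediate_field ?M" and F: "intermediate_field ?F"
      using intermediate_frobenius_fixed[OF frob] by blast+
    have "infinite (rational_points E ?F) \<or> card (rational_points E ?F) \<ge> card ?M"
    proof (rule card_rational_points[OF two F])
      show "?M \<subseteq> ?F"
      proof
        fix x assume "x \<in> ?M"
        hence fixed: "x ^ (CHAR('a) ^ (m * (2 * n))) = x"
          unfolding frobenius_fixed_def[OF frob] by (rule CollectD)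
        \<comment> \<open>The larger exponent amounts to applying the same Frobenius power twice, so
          elements fixed once stay fixed.\<close>
        have split: "m * (2 * (2 * n)) = m * (2 * n) + m * (2 * n)" by simp
        have "x ^ (CHAR('a) ^ (m * (2 * (2 * n)))) = x"
          unfolding split power_add power_mult[of x] fixed by (rule refl)
        thus "x \<in> ?F" unfolding frobenius_fixed_def[OF frob] by (rule CollectI)
      qed
      fix x s
      assume x: "x \<in> ?M" and s: "s ^ 2 =
        (a1 (base_change to_ac E) * x + a3 (base_change to_ac E)) ^ 2 +
        4 * (x ^ 3 + a2 (base_change to_ac E) * x ^ 2 + a4 (base_change to_ac E) * x +
          a6 (base_change to_ac E))"
      have "s ^ 2 \<in> ?M"
        unfolding s base_change_def weierstrass.simps
        by (intro intermediate_field_closed[OF F0] x)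
      thus "s \<in> ?F" by (rule sqrt_in_frobenius_fixed[OF frob odd])
    qed
    moreover have "card ?M \<ge> 2 * n"
    proof -
      have "2 * n \<le> m * (2 * n)" using m(1) by simp
      also have "\<dots> < 2 ^ (m * (2 * n))" by (rule less_exp)
      also have "\<dots> \<le> CHAR('a) ^ (m * (2 * n))"
        using prime_ge_2_nat[OF prime] by (intro power_mono) simp_all
      finally show ?thesis using card_frobenius_fixed[OF frob pos(1)] by simp
    qed
    ultimately show ?thesis
      using finite_degree_frobenius_fixed[OF frob pos(2)] solvable_frobenius_fixed[OF frob pos(2)]
      by (intro exI[of _ ?F]) auto
  qed
qed

end
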